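(* Let $\mathcal{A}\in\mathbb{C}^{n\times n\times p}$ be a complex Hermitian tensor, i.e. $\mathcal{A}^H=\mathcal{A}$. Then $\mathcal{A}$ can be factorized as $$\mathcal{A}=\mathcal{U}*\mathcal{P},$$ where $\mathcal{U}\in\mathbb{C}^{n\times n\times p}$ is a unitary tensor and $\mathcal{P}\in\mathbb{C}^{n\times n\times p}$ is a T-positive definite or T-positive semi-definite tensor.
   Context: For $\mathcal{A}\in\mathbb{C}^{m\times n\times p}$ let $A^{(1)},\dots,A^{(p)}\in\mathbb{C}^{m\times n}$ be its frontal slices. $\mathrm{bcirc}(\mathcal{A})$ is the $mp\times np$ block circulant matrix whose $(i,j)$ block ($1\le i,j\le p$) is $A^{(((i-j)\bmod p)+1)}$; $\mathrm{unfold}(\mathcal{A})$ is the $mp\times n$ matrix obtained by stacking $A^{(1)},\dots,A^{(p)}$ vertically, and $\mathrm{fold}$ is the inverse of $\mathrm{unfold}$. The T-product is $\mathcal{A}*\mathcal{B}=\mathrm{fold}(\mathrm{bcirc}(\mathcal{A})\,\mathrm{unfold}(\mathcal{B}))$. The identity tensor $\mathcal{I}$ has first frontal slice $I_n$ and other slices zero. The conjugate transpose $\mathcal{A}^H$ is obtained by conjugate transposing each frontal slice and then reversing the order of the conjugate transposed slices $2$ through $p$ (so $\mathrm{bcirc}(\mathcal{A}^H)=\mathrm{bcirc}(\mathcal{A})^H$). $\mathcal{U}$ is unitary if $\mathcal{U}^H*\mathcal{U}=\mathcal{U}*\mathcal{U}^H=\mathcal{I}$. Let $F_p$ be the unitary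 $p\times p$ discrete Fourier matrix with entries $\frac{1}{\sqrt p}\omega^{(j-1)(k-1)}$, $\omega=e^{-2\pi\mathbf{i}/p}$. A Hermitian tensor $\mathcal{P}\in\mathbb{C}^{n\times n\times p}$ with $\mathrm{bcirc}(\mathcal{P})=(F_p^H\otimes I_n)\,\mathrm{diag}(P_1,\dots,P_p)\,(F_p\otimes I_n)$ is T-positive definite (respectively T-positive semi-definite) if all the Hermitian matrices $P_i$ are positive definite (respectively positive semi-definite). *)

theory Defs
  imports "Jordan_Normal_Form.Schur_Decomposition"
begin

section \<open>Third-order tensors and the T-product\<close>

text \<open>
  A tensor of size m x n x p is the list of its p frontal slices. All indices are 0-based, so
  \<^term>\<open>A ! k\<close> is the slice usually written with superscript k+1.
\<close>

type_synonym tensor3 = "complex mat list"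

definition carrier_tensor :: "nat \<Rightarrow> nat \<Rightarrow> nat \<Rightarrow> tensor3 set" where
  "carrier_tensor m n p = {A. length A = p \<and> set A \<subseteq> carrier_mat m n}"

text \<open>In a nonempty tensor all slices have the dimensions of the first one.\<close>

definition trows :: "tensor3 \<Rightarrow> nat" where
  "trows A = dim_row (A ! 0)"

definition tcols :: "tensor3 \<Rightarrow> nat" where
  "tcols A = dim_col (A ! 0)"

text \<open>
  Adding \<^term>\<open>length A\<close> before subtracting avoids truncation on the natural numbers: the block
  in block row r and block column c is the slice with index (r - c) mod p.
\<close>

definition bcirc :: "tensor3 \<Rightarrow> complex mat" where
  "bcirc A = mat (length A * trows A) (length A * tcols A)
     (\<lambda>(i, j). (A ! ((length A + i div trows A - j div tcols A) mod length A))
                 $$ (i mod trows A, j mod tcols A))"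

definition tunfold :: "tensor3 \<Rightarrow> complex mat" where
  "tunfold A = mat (length A * trows A) (tcols A)
     (\<lambda>(i, j). (A ! (i div trows A)) $$ (i mod trows A, j))"

definition tfold :: "nat \<Rightarrow> complex mat \<Rightarrow> tensor3" where
  "tfold p M = map (\<lambda>k. mat (dim_row M div p) (dim_col M)
     (\<lambda>(i, j). M $$ (k * (dim_row M div p) + i, j))) [0..<p]"

definition tprod :: "tensor3 \<Rightarrow> tensor3 \<Rightarrow> tensor3" (infixl \<open>\<star>\<close> 70) where
  "A \<star> B = tfold (length A) (bcirc A * tunfold B)"

definition tident :: "nat \<Rightarrow> nat \<Rightarrow> tensor3" where
  "tident n p = map (\<lambda>k. if k = 0 then 1\<^sub>m n else 0\<^sub>m n n) [0..<p]"

definition tadjoint :: "tensor3 \<Rightarrow> tensor3" where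
  "tadjoint A = (case A of [] \<Rightarrow> [] | S # Ss \<Rightarrow> mat_adjoint S # rev (map mat_adjoint Ss))"

definition hermitian_tensor :: "tensor3 \<Rightarrow> bool" where
  "hermitian_tensor A \<longleftrightarrow> tadjoint A = A"

definition unitary_tensor :: "nat \<Rightarrow> nat \<Rightarrow> tensor3 \<Rightarrow> bool" where
  "unitary_tensor n p U \<longleftrightarrow> U \<in> carrier_tensor n n p \<and>
     tadjoint U \<star> U = tident n p \<and> U \<star> tadjoint U = tident n p"

section \<open>Fourier matrix, Kronecker product and T-positivity\<close>

definition dft_mat :: "nat \<Rightarrow> complex mat" where
  "dft_mat p = mat p p (\<lambda>(j, k). 1 / complex_of_real (sqrt (real p)) *
     exp (- 2 * complex_of_real pi * \<i> / of_nat p) ^ (j * k))"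

definition kron :: "complex mat \<Rightarrow> complex mat \<Rightarrow> complex mat" (infixl \<open>\<otimes>\<^sub>K\<close> 70) where
  "A \<otimes>\<^sub>K B = mat (dim_row A * dim_row B) (dim_col A * dim_col B)
     (\<lambda>(i, j). A $$ (i div dim_row B, j div dim_col B) * B $$ (i mod dim_row B, j mod dim_col B))"

definition hermitian_mat :: "complex mat \<Rightarrow> bool" where
  "hermitian_mat M \<longleftrightarrow> mat_adjoint M = M"

text \<open>
  \<^term>\<open>(M *\<^sub>v v) \<bullet>c v\<close> is the quadratic form of M at v. The order on \<^typ>\<open>complex\<close> is the one
  comparing real parts of numbers with equal imaginary part, so being nonnegative includes being real.
\<close>

definition pos_def_mat :: "nat \<Rightarrow> complex mat \<Rightarrow> bool" where
  "pos_def_mat n M \<longleftrightarrow> M \<in> carrier_mat n n \<and> hermitian_mat M \<and>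
     (\<forall>v \<in> carrier_vec n. v \<noteq> 0\<^sub>v n \<longrightarrow> 0 < (M *\<^sub>v v) \<bullet>c v)"

definition pos_semidef_mat :: "nat \<Rightarrow> complex mat \<Rightarrow> bool" where
  "pos_semidef_mat n M \<longleftrightarrow> M \<in> carrier_mat n n \<and> hermitian_mat M \<and>
     (\<forall>v \<in> carrier_vec n. 0 \<le> (M *\<^sub>v v) \<bullet>c v)"

definition fourier_blocks :: "nat \<Rightarrow> nat \<Rightarrow> tensor3 \<Rightarrow> complex mat list \<Rightarrow> bool" where
  "fourier_blocks n p P Ds \<longleftrightarrow> length Ds = p \<and> set Ds \<subseteq> carrier_mat n n \<and>
     bcirc P = (mat_adjoint (dft_mat p) \<otimes>\<^sub>K 1\<^sub>m n) * diag_block_mat Ds * (dft_mat p \<otimes>\<^sub>K 1\<^sub>m n)"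

text \<open>
  The diagonal blocks are uniquely determined by P, because the outer factors are unitary; hence the
  existential quantifier refers to the blocks of P.
\<close>

definition T_pos_def :: "nat \<Rightarrow> nat \<Rightarrow> tensor3 \<Rightarrow> bool" where
  "T_pos_def n p P \<longleftrightarrow> P \<in> carrier_tensor n n p \<and> hermitian_tensor P \<and>
     (\<exists>Ds. fourier_blocks n p P Ds \<and> (\<forall>D \<in> set Ds. pos_def_mat n D))"

definition T_pos_semidef :: "nat \<Rightarrow> nat \<Rightarrow> tensor3 \<Rightarrow> bool" where
  "T_pos_semidef n p P \<longleftrightarrow> P \<in> carrier_tensor n n p \<and> hermitian_tensor P \<and>
     (\<exists>Ds. fourier_blocks n p P Ds \<and> (\<forall>D \<in> set Ds. pos_semidef_mat n D))"

section \<open>Sanity checks\<close>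

lemma carrier_tensor_dims:
  assumes "A \<in> carrier_tensor m n p" "0 < p"
  shows "length A = p" "trows A = m" "tcols A = n" "\<And>k. k < p \<Longrightarrow> A ! k \<in> carrier_mat m n"
proof -
  show *: "length A = p" and **: "\<And>k. k < p \<Longrightarrow> A ! k \<in> carrier_mat m n"
    using assms by (auto simp: carrier_tensor_def)
  show "trows A = m" "tcols A = n"
    using **[OF assms(2)] by (auto simp: trows_def tcols_def)
qed

lemma tfold_tunfold:
  assumes "A \<in> carrier_tensor m n p" "0 < p"
  shows "tfold p (tunfold A) = A"
proof (rule nth_equalityI)
  note d = carrier_tensor_dims[OF assms]
  show "length (tfold p (tunfold A)) = length A" by (simp add: tfold_def d)
  fix k assume "k < length (tfold p (tunfold A))"
  then have k: "k < p" by (simp add: tfold_def)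
  have bnd: "k * m + i < p * m" if "i < m" for i
  proof -
    have "k * m + i < Suc k * m" using that by simp
    also have "\<dots> \<le> p * m" using k by (intro mult_le_mono1) simp
    finally show ?thesis .
  qed
  show "tfold p (tunfold A) ! k = A ! k"
    by (rule eq_matI) (use k assms(2) d(4)[OF k] bnd in
      \<open>auto simp: tfold_def tunfold_def d(1-3)\<close>)
qed

lemma tunfold_tfold:
  assumes "M \<in> carrier_mat (p * m) n" "0 < p"
  shows "tfold p M \<in> carrier_tensor m n p" "tunfold (tfold p M) = M"
proof -
  show c: "tfold p M \<in> carrier_tensor m n p"
    using assms by (auto simp: tfold_def carrier_tensor_def)
  note d = carrier_tensor_dims[OF c assms(2)]
  have *: "i div m < p" "i mod m < m" if "i < p * m" for i
    using that by (auto simp: less_mult_imp_div_less) (metis gr_zeroI mod_less_divisor mult_0_right not_less0)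
  show "tunfold (tfold p M) = M"
    by (rule eq_matI)
       (use assms * in \<open>auto simp: tunfold_def d(1-3), auto simp: tfold_def\<close>)
qed

lemma mat_adjoint_index:
  assumes "i < dim_col M" "j < dim_row M"
  shows "mat_adjoint M $$ (i, j) = cnj (M $$ (j, i))"
  using assms by (simp add: mat_adjoint_def mat_of_rows_def conjugate_complex_def)

lemma tadjoint_nth:
  assumes "k < length A"
  shows "tadjoint A ! k = mat_adjoint (A ! ((length A - k) mod length A))"
proof (cases A)
  case (Cons S Ss)
  then show ?thesis
  proof (cases k)
    case (Suc l)
    then show ?thesis using Cons assms
      by (simp add: tadjoint_def rev_nth mod_less nth_Cons')
  qed (simp add: tadjoint_def)
qed (use assms in simp)

lemma bcirc_tadjoint:
  assumes A: "A \<in> carrier_tensor m n p" and p: "0 < p"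
  shows "bcirc (tadjoint A) = mat_adjoint (bcirc A)"
proof -
  note d = carrier_tensor_dims[OF A p]
  have len: "length (tadjoint A) = p" using d(1) by (auto simp: tadjoint_def split: list.splits)
  have sl: "mat_adjoint (A ! k) \<in> carrier_mat n m" if "k < p" for k
    using d(4)[OF that] by (auto simp: mat_adjoint_def)
  have "tadjoint A \<in> carrier_tensor n m p"
    using len sl d(1) p by (auto simp: carrier_tensor_def in_set_conv_nth tadjoint_nth)
  note e = carrier_tensor_dims[OF this p]
  have *: "(p - (p + r - c) mod p) mod p = (p + c - r) mod p" if "r < p" "c < p" for r c
    using that by (cases "c \<le> r"; cases "r = c") (auto simp: mod_if)
  have dv: "i div q < p" "i mod q < q" if "i < p * q" for i q
    using that by (auto simp: less_mult_imp_div_less) (metis gr_zeroI mod_less_divisor mult_0_right not_less0)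
  show ?thesis
  proof (rule eq_matI)
    show "dim_row (bcirc (tadjoint A)) = dim_row (mat_adjoint (bcirc A))"
      "dim_col (bcirc (tadjoint A)) = dim_col (mat_adjoint (bcirc A))"
      by (simp_all add: bcirc_def mat_adjoint_def d e)
    fix i j assume "i < dim_row (mat_adjoint (bcirc A))" "j < dim_col (mat_adjoint (bcirc A))"
    then have i: "i < p * n" and j: "j < p * m"
      by (simp_all add: bcirc_def mat_adjoint_def d)
    let ?k = "(p + i div n - j div m) mod p"
    let ?l = "(p + j div m - i div n) mod p"
    have kl: "?k < p" "?l < p" using p by simp_all
    have "bcirc (tadjoint A) $$ (i, j) = mat_adjoint (A ! ?l) $$ (i mod n, j mod m)"
      using i j kl *[OF dv(1)[OF i] dv(1)[OF j]] by (simp add: bcirc_def e(1-3) tadjoint_nth d(1))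
    also have "\<dots> = cnj ((A ! ?l) $$ (j mod m, i mod n))"
      using d(4)[OF kl(2)] dv(2)[OF i] dv(2)[OF j] by (intro mat_adjoint_index) auto
    also have "\<dots> = mat_adjoint (bcirc A) $$ (i, j)"
      using i j by (subst mat_adjoint_index) (simp_all add: bcirc_def d(1-3))
    finally show "bcirc (tadjoint A) $$ (i, j) = mat_adjoint (bcirc A) $$ (i, j)" .
  qed
qed

end

theory Submission
  imports Defs "Jordan_Normal_Form.Spectral_Radius"
begin

text \<open>
  The discrete Fourier transform along the third index turns the T-product into a blockwise matrix
  product. More precisely, sending a family D of p square matrices to the tensor
  \<open>tensor_of_blocks n p D\<close> with these Fourier blocks respects products
  (\<open>tprod_tensor_of_blocks\<close>), adjoints (\<open>tadjoint_tensor_of_blocks\<close>) and the identity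
  (\<open>tident_eq_tensor_of_blocks\<close>), and these blocks are the diagonal blocks by which T-positivity is
  defined (\<open>fourier_blocks_tensor_of_blocks\<close>). The first of these facts is the convolution theorem for
  the discrete Fourier transform (\<open>idft_convolution\<close>).

  A Hermitian tensor has Hermitian Fourier blocks (\<open>hermitian_tensor_blocks\<close>). Each of them has a
  polar decomposition into a unitary and a positive semidefinite matrix
  (\<open>hermitian_polar_decomposition\<close>): split off one eigenvector at a time and write the eigenvalue
  as its sign times its absolute value. The tensors assembled from the unitary matrices and from the
  positive semidefinite ones are the two factors. Since blocks may be singular, the second factor is
  obtained as a T-positive semidefinite tensor.
\<close>

section \<open>The discrete Fourier transform of sequences\<close>

text \<open>
  The powers of the conjugate of the Fourier root, with integer exponents: the entries of the Fourier
  matrix are \<^term>\<open>root_char p (- (int j * int k))\<close> up to scaling. Integer exponents let the index differences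
  of a circulant matrix be subtracted without truncation and reduced modulo p at will.
\<close>

definition root_char :: "nat \<Rightarrow> int \<Rightarrow> complex" where
  "root_char p x = cis (2 * pi * of_int x / of_nat p)"

lemma root_char_add: "root_char p (x + y) = root_char p x * root_char p y"
  by (simp add: root_char_def cis_mult ring_distribs add_divide_distrib)

lemma root_char_0 [simp]: "root_char p 0 = 1"
  by (simp add: root_char_def)

lemma root_char_power: "root_char p (x * int k) = root_char p x ^ k"
  by (induction k) (simp_all add: ring_distribs root_char_add mult.commute)

lemma cnj_root_char: "cnj (root_char p x) = root_char p (- x)"
  by (simp add: root_char_def cis_cnj)

lemma root_char_eq_1_iff:
  assumes "0 < p"
  shows "root_char p x = 1 \<longleftrightarrow> int p dvd x"
proof
  assume "root_char p x = 1"
  then have "cos (2 * pi * of_int x / of_nat p) = 1"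
    by (metis cis.sel(1) one_complex.sel(1) root_char_def)
  then obtain m :: int where "2 * pi * of_int x / of_nat p = of_int m * 2 * pi"
    by (auto simp: cos_one_2pi_int)
  then have "real_of_int x = of_int (int p * m)"
    using assms by (simp add: field_simps)
  then show "int p dvd x"
    by (metis dvd_triv_left of_int_eq_iff)
next
  assume "int p dvd x"
  then obtain m where "x = int p * m" ..
  then have "2 * pi * of_int x / of_nat p = 2 * pi * of_int m"
    using assms by (simp add: field_simps)
  then show "root_char p x = 1"
    by (simp add: root_char_def cis_multiple_2pi)
qed

lemma root_char_mod:
  assumes "0 < p"
  shows "root_char p (x * (y mod int p)) = root_char p (x * y)"
proof -
  have "x * y = x * (y mod int p) + int p * (x * (y div int p))"
    by (metis distrib_left mod_mult_div_eq mult.left_commute)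
  moreover have "root_char p (int p * (x * (y div int p))) = 1"
    using assms by (simp add: root_char_eq_1_iff)
  ultimately show ?thesis
    by (metis mult.right_neutral root_char_add)
qed

text \<open>
  Orthogonality of characters: if p does not divide x, the terms form a geometric progression whose
  ratio is a p-th root of unity other than 1.
\<close>

lemma sum_root_char:
  assumes "0 < p"
  shows "(\<Sum>k<p. root_char p (x * int k)) = (if int p dvd x then of_nat p else 0)"
proof (cases "int p dvd x")
  case True
  then show ?thesis
    using assms by (simp add: root_char_power root_char_eq_1_iff[THEN iffD2])
next
  case False
  then have "root_char p x \<noteq> 1"
    using assms by (simp add: root_char_eq_1_iff)
  moreover have "root_char p x ^ p = 1"
    using assms by (simp flip: root_char_power add: root_char_eq_1_iff)
  ultimately show ?thesis
    using False by (simp add: root_char_power geometric_sum)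
qed

lemma dvd_diff_less_iff:
  assumes "i < p" "j < p"
  shows "int p dvd int i - int j \<longleftrightarrow> i = j"
  by (metis assms mod_eq_dvd_iff mod_less zmod_int of_nat_eq_iff)

text \<open>
  The inverse discrete Fourier transform. The argument is an integer because the result is p-periodic
  (lemma \<open>idft_mod\<close>), so that it can be evaluated at the differences that occur in cyclic convolutions.
\<close>

definition idft :: "nat \<Rightarrow> (nat \<Rightarrow> complex) \<Rightarrow> int \<Rightarrow> complex" where
  "idft p f x = (\<Sum>j<p. root_char p (int j * x) * f j) / of_nat p"

lemma idft_cong: "(\<And>j. j < p \<Longrightarrow> f j = g j) \<Longrightarrow> idft p f x = idft p g x"
  by (simp add: idft_def)

lemma idft_mod: "0 < p \<Longrightarrow> idft p f (x mod int p) = idft p f x"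
  by (simp add: idft_def root_char_mod)

lemma cnj_idft: "cnj (idft p f x) = idft p (\<lambda>j. cnj (f j)) (- x)"
  by (simp add: idft_def cnj_root_char)

lemma idft_sum: "(\<Sum>c\<in>C. idft p (f c) x) = idft p (\<lambda>j. \<Sum>c\<in>C. f c j) x"
  unfolding idft_def sum_distrib_left sum_divide_distrib by (rule sum.swap)

lemma idft_const:
  assumes "0 < p" "k < p"
  shows "idft p (\<lambda>_. c) (int k) = (if k = 0 then c else 0)"
proof -
  have "idft p (\<lambda>_. c) (int k) = (\<Sum>j<p. root_char p (int k * int j)) * c / of_nat p"
    by (simp add: idft_def sum_distrib_right mult.commute[of "int k"])
  also have "\<dots> = (if k = 0 then c else 0)"
    using assms by (auto simp: sum_root_char zdvd_not_zless)
  finally show ?thesis .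
qed

text \<open>
  Expanding both transforms, the sum over l sees only the characters; by orthogonality it
  annihilates every mixed term with i different from j.
\<close>

lemma idft_convolution:
  assumes "0 < p"
  shows "(\<Sum>l<p. idft p f (x - int l) * idft p g (int l)) = idft p (\<lambda>j. f j * g j) x"
proof -
  have rc: "root_char p (int i * (x - int l)) * root_char p (int j * int l)
      = root_char p (int i * x) * root_char p ((int j - int i) * int l)" for i j l
    by (simp flip: root_char_add add: algebra_simps)
  have "(\<Sum>l<p. idft p f (x - int l) * idft p g (int l))
      = (\<Sum>l<p. \<Sum>i<p. \<Sum>j<p. (root_char p (int i * (x - int l)) * root_char p (int j * int l))
           * (f i * g j)) / of_nat p ^ 2"
    unfolding idft_def sum_divide_distrib[symmetric] times_divide_times_eq sum_product
    by (simp add: power2_eq_square mult_ac)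
  also have "\<dots> = (\<Sum>i<p. \<Sum>j<p. root_char p (int i * x) * (f i * g j)
           * (\<Sum>l<p. root_char p ((int j - int i) * int l))) / of_nat p ^ 2"
    unfolding rc sum_distrib_left
    by (subst sum.swap, subst (2) sum.swap) (simp add: mult_ac)
  also have "\<dots> = (\<Sum>i<p. \<Sum>j<p. if i = j then root_char p (int i * x) * (f i * g j) * of_nat p else 0)
           / of_nat p ^ 2"
    using assms by (intro arg_cong2[where f = "(/)"] sum.cong refl)
      (auto simp: sum_root_char dvd_diff_less_iff)
  also have "\<dots> = (\<Sum>i<p. root_char p (int i * x) * (f i * g i)) * of_nat p / of_nat p ^ 2"
    by (simp add: sum_distrib_right)
  also have "\<dots> = idft p (\<lambda>j. f j * g j) x"
    using assms by (simp add: idft_def power2_eq_square)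
  finally show ?thesis .
qed

lemma idft_inversion:
  assumes "0 < p" "m < p"
  shows "idft p (\<lambda>j. \<Sum>k<p. root_char p (- (int j * int k)) * h k) (int m) = h m"
proof -
  have rc: "root_char p (int j * int m) * root_char p (- (int j * int k))
      = root_char p ((int m - int k) * int j)" for j k
    by (simp flip: root_char_add add: algebra_simps)
  have "idft p (\<lambda>j. \<Sum>k<p. root_char p (- (int j * int k)) * h k) (int m)
      = (\<Sum>j<p. \<Sum>k<p. root_char p ((int m - int k) * int j) * h k) / of_nat p"
    by (simp add: idft_def sum_distrib_left mult.assoc flip: rc)
  also have "\<dots> = (\<Sum>k<p. (\<Sum>j<p. root_char p ((int m - int k) * int j)) * h k) / of_nat p"
    by (subst sum.swap) (simp add: sum_distrib_right)
  also have "\<dots> = (\<Sum>k<p. if k = m then of_nat p * h k else 0) / of_nat p"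
    using assms by (intro arg_cong2[where f = "(/)"] sum.cong refl)
      (auto simp: sum_root_char dvd_diff_less_iff)
  also have "\<dots> = h m"
    using assms by simp
  finally show ?thesis .
qed

section \<open>Polar decomposition of Hermitian matrices\<close>

lemma dim_mat_adjoint [simp]:
  "dim_row (mat_adjoint M) = dim_col M" "dim_col (mat_adjoint M) = dim_row M"
  by (simp_all add: mat_adjoint_def)

lemma mat_adjoint_carrier [simp]: "M \<in> carrier_mat m n \<Longrightarrow> mat_adjoint M \<in> carrier_mat n m"
  by (intro carrier_matI) auto

lemma mat_adjoint_mat_adjoint [simp]: "mat_adjoint (mat_adjoint M) = (M :: complex mat)"
  by (rule eq_matI) (auto simp: mat_adjoint_index)

lemma mat_adjoint_mult:
  fixes M N :: "complex mat"
  assumes "M \<in> carrier_mat m k" "N \<in> carrier_mat k n"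
  shows "mat_adjoint (M * N) = mat_adjoint N * mat_adjoint M"
  using assms
  by (intro eq_matI)
     (auto simp: mat_adjoint_index scalar_prod_def mult.commute intro!: sum.cong)

lemma mat_adjoint_four_block:
  fixes A B C D :: "complex mat"
  assumes "A \<in> carrier_mat n1 m1" "B \<in> carrier_mat n1 m2"
    "C \<in> carrier_mat n2 m1" "D \<in> carrier_mat n2 m2"
  shows "mat_adjoint (four_block_mat A B C D)
    = four_block_mat (mat_adjoint A) (mat_adjoint C) (mat_adjoint B) (mat_adjoint D)"
  using assms by (intro eq_matI) (auto simp: mat_adjoint_index)

text \<open>
  The quadratic form at v is the squared norm of \<^term>\<open>B *\<^sub>v v\<close>.
\<close>

lemma pos_semidef_gram:
  assumes B: "B \<in> carrier_mat n n"
  shows "pos_semidef_mat n (mat_adjoint B * B)"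
  unfolding pos_semidef_mat_def hermitian_mat_def
proof (intro conjI ballI)
  show "mat_adjoint B * B \<in> carrier_mat n n" using B by (auto intro: mult_carrier_mat)
  show "mat_adjoint (mat_adjoint B * B) = mat_adjoint B * B"
    using B by (simp add: mat_adjoint_mult[of _ n n])
  fix v :: "complex vec" assume v: "v \<in> carrier_vec n"
  have adj: "(mat_adjoint B *\<^sub>v x) \<bullet>c v = x \<bullet>c (B *\<^sub>v v)" if x: "x \<in> carrier_vec n" for x
  proof -
    have "(mat_adjoint B *\<^sub>v x) \<bullet>c v = (\<Sum>i<n. \<Sum>k<n. cnj (B $$ (k, i)) * x $ k * cnj (v $ i))"
      using B v x by (simp add: scalar_prod_def mat_adjoint_index sum_distrib_right lessThan_atLeast0)
    also have "\<dots> = (\<Sum>k<n. \<Sum>i<n. cnj (B $$ (k, i)) * x $ k * cnj (v $ i))"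
      by (rule sum.swap)
    also have "\<dots> = x \<bullet>c (B *\<^sub>v v)"
      using B v x by (simp add: scalar_prod_def sum_distrib_left lessThan_atLeast0 mult_ac)
    finally show ?thesis .
  qed
  have "((mat_adjoint B * B) *\<^sub>v v) \<bullet>c v = (B *\<^sub>v v) \<bullet>c (B *\<^sub>v v)"
    using B v adj[of "B *\<^sub>v v"] by (simp add: assoc_mult_mat_vec[of _ n n _ n])
  then show "0 \<le> ((mat_adjoint B * B) *\<^sub>v v) \<bullet>c v"
    by (simp add: conjugate_square_ge_0_vec)
qed

text \<open>
  Complete v to a basis, orthogonalise starting from v, and normalise; the first step of the
  Gram-Schmidt process leaves v itself unchanged.
\<close>

lemma unitary_with_first_column:
  fixes v :: "complex vec"
  assumes v: "v \<in> carrier_vec n" and v0: "v \<noteq> 0\<^sub>v n"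
  obtains W c where "W \<in> carrier_mat n n" "mat_adjoint W * W = 1\<^sub>m n"
    "c \<noteq> 0" "col W 0 = c \<cdot>\<^sub>v v"
proof -
  interpret cof_vec_space n "TYPE(complex)" .
  define ws where "ws = gram_schmidt n (basis_completion v)"
  note bc = basis_completion[OF v v0]
  note gs = gram_schmidt_result[OF bc(2,4,5) ws_def]
  have n: "0 < n"
    using v v0 by (cases n) auto
  have len: "length ws = n" using gs bc by simp
  have hd: "ws ! 0 = v"
  proof -
    have "basis_completion v = v # tl (basis_completion v)"
      using bc(6,7) n by (cases "basis_completion v") auto
    then have "hd ws = v"
      using gram_schmidt_hd[OF v] unfolding ws_def by metis
    then show ?thesis using len n by (cases ws) auto
  qed
  have car: "ws ! i \<in> carrier_vec n" if "i < n" for i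
    using gs(3) len that by (metis nth_mem subsetD)
  define r where "r i = complex_of_real (sqrt (Re (ws ! i \<bullet>c ws ! i)))" for i
  have r: "r i * r i = ws ! i \<bullet>c ws ! i" "r i \<noteq> 0" "cnj (r i) = r i" if "i < n" for i
  proof -
    have "0 \<le> ws ! i \<bullet>c ws ! i" by (rule conjugate_square_ge_0_vec)
    moreover have "ws ! i \<bullet>c ws ! i \<noteq> 0"
      using corthogonalD[OF gs(2), of i i] that len by simp
    ultimately have *: "Re (ws ! i \<bullet>c ws ! i) > 0" "Im (ws ! i \<bullet>c ws ! i) = 0"
      by (auto simp: less_eq_complex_def complex_eq_iff)
    then show "r i * r i = ws ! i \<bullet>c ws ! i"
      by (simp add: r_def complex_eq_iff)
    show "r i \<noteq> 0" using * by (auto simp: r_def)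
    show "cnj (r i) = r i" by (simp add: r_def)
  qed
  define W where "W = mat n n (\<lambda>(i, j). ws ! j $ i / r j)"
  show ?thesis
  proof (rule that[of W "1 / r 0"])
    show W: "W \<in> carrier_mat n n" by (simp add: W_def)
    show "1 / r 0 \<noteq> 0" using r n by simp
    show "col W 0 = (1 / r 0) \<cdot>\<^sub>v v"
      using v n hd by (intro eq_vecI) (auto simp: W_def)
    show "mat_adjoint W * W = 1\<^sub>m n"
    proof (rule eq_matI)
      fix i j assume "i < dim_row (1\<^sub>m n :: complex mat)" "j < dim_col (1\<^sub>m n :: complex mat)"
      then have ij: "i < n" "j < n" by auto
      have "(mat_adjoint W * W) $$ (i, j) = (\<Sum>k<n. cnj (W $$ (k, i)) * W $$ (k, j))"
        using W ij by (simp add: scalar_prod_def mat_adjoint_index lessThan_atLeast0)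
      also have "\<dots> = (\<Sum>k<n. ws ! j $ k * cnj (ws ! i $ k) / (r i * r j))"
        using ij r(3) by (intro sum.cong) (simp_all add: W_def)
      also have "\<dots> = (ws ! j \<bullet>c ws ! i) / (r i * r j)"
        using car[OF ij(1)] car[OF ij(2)]
        by (simp add: scalar_prod_def lessThan_atLeast0 sum_divide_distrib)
      also have "\<dots> = 1\<^sub>m n $$ (i, j)"
        using ij r corthogonalD[OF gs(2), of j i] len by (cases "i = j") auto
      finally show "(mat_adjoint W * W) $$ (i, j) = 1\<^sub>m n $$ (i, j)" .
    qed (use W in auto)
  qed
qed

text \<open>
  Induction by deflation. In an orthonormal basis starting with an eigenvector, the matrix becomes
  the direct sum of the eigenvalue e and a smaller Hermitian matrix: the first column is a multiple
  of the first unit vector because its basis vector is an eigenvector, and then so is the first row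
  by symmetry. The number e has the polar decomposition \<open>e = sgn e * cmod e\<close>, the smaller matrix
  has one by induction, and polar decompositions are compatible with direct sums and with unitary
  changes of basis.

  The positive factor is delivered as a Gram matrix of some B. In this form both positivity and
  symmetry are evident, and only B has to be carried through the induction.
\<close>

lemma hermitian_polar_decomposition:
  fixes A :: "complex mat"
  assumes "A \<in> carrier_mat n n" "hermitian_mat A"
  shows "\<exists>U B. U \<in> carrier_mat n n \<and> B \<in> carrier_mat n n \<and>
    mat_adjoint U * U = 1\<^sub>m n \<and> A = U * (mat_adjoint B * B)"
  using assms
proof (induction n arbitrary: A)
  case 0
  then show ?case
    by (intro exI[of _ "0\<^sub>m 0 0"]) (auto intro!: eq_matI)
next
  case (Suc n A)
  let ?m = "Suc n"
  note [simp] = mult_carrier_mat[of _ n n _ n] mult_carrier_mat[of _ ?m ?m _ ?m]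
  note A = Suc.prems(1)
  from spectrum_non_empty[OF A] obtain e where "eigenvalue A e"
    by (auto simp: spectrum_def)
  then obtain v where v: "v \<in> carrier_vec ?m" "v \<noteq> 0\<^sub>v ?m" and Av: "A *\<^sub>v v = e \<cdot>\<^sub>v v"
    using A by (auto simp: eigenvalue_def eigenvector_def)
  obtain W c where W: "W \<in> carrier_mat ?m ?m" and WW: "mat_adjoint W * W = 1\<^sub>m ?m"
    and c: "c \<noteq> 0" "col W 0 = c \<cdot>\<^sub>v v"
    using unitary_with_first_column[OF v] by metis
  have W': "mat_adjoint W \<in> carrier_mat ?m ?m" using W by simp
  have WW': "W * mat_adjoint W = 1\<^sub>m ?m"
    by (rule mat_mult_left_right_inverse[OF W' W WW])
  define T where "T = mat_adjoint W * A * W"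
  have T: "T \<in> carrier_mat ?m ?m" using W A by (simp add: T_def)
  have adjT: "mat_adjoint T = T"
    using Suc.prems W W' unfolding T_def hermitian_mat_def
    by (simp add: mat_adjoint_mult[of _ ?m ?m _ ?m] assoc_mult_mat[of _ ?m ?m _ ?m _ ?m])
  have AT: "A = W * T * mat_adjoint W"
  proof -
    have "W * T * mat_adjoint W = (W * mat_adjoint W) * A * (W * mat_adjoint W)"
      using W W' A by (simp add: T_def assoc_mult_mat[of _ ?m ?m _ ?m _ ?m])
    then show ?thesis using A by (simp add: WW')
  qed
  have T0: "T $$ (i, 0) = (if i = 0 then e else 0)" if "i < ?m" for i
  proof -
    have "col (A * W) 0 = A *\<^sub>v col W 0"
      using A W by (intro col_mult2[of _ ?m ?m _ ?m]) auto
    also have "\<dots> = e \<cdot>\<^sub>v col W 0"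
      using A v Av c by (simp add: mult_mat_vec smult_smult_assoc mult.commute)
    finally have "T $$ (i, 0) = row (mat_adjoint W) i \<bullet> (e \<cdot>\<^sub>v col W 0)"
      using that A W W' by (simp add: T_def assoc_mult_mat[of _ ?m ?m _ ?m _ ?m])
    also have "\<dots> = e * (mat_adjoint W * W) $$ (i, 0)"
      using that W W' by simp
    finally show ?thesis using that by (simp add: WW)
  qed
  have T0': "T $$ (0, i) = 0" if "0 < i" "i < ?m" for i
    using T0[of i] that T by (subst adjT[symmetric]) (simp add: mat_adjoint_index)
  define S where "S = mat n n (\<lambda>(i, j). T $$ (Suc i, Suc j))"
  have S: "S \<in> carrier_mat n n" by (simp add: S_def)
  have "hermitian_mat S"
    unfolding hermitian_mat_def
  proof (rule eq_matI)
    fix i j assume ij: "i < dim_row S" "j < dim_col S"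
    then have "T $$ (Suc i, Suc j) = cnj (T $$ (Suc j, Suc i))"
      using T S by (subst adjT[symmetric]) (simp add: mat_adjoint_index)
    then show "mat_adjoint S $$ (i, j) = S $$ (i, j)"
      using ij by (simp add: S_def mat_adjoint_index)
  qed (use S in auto)
  from Suc.IH[OF S this] obtain U B where U: "U \<in> carrier_mat n n" and B: "B \<in> carrier_mat n n"
    and UU: "mat_adjoint U * U = 1\<^sub>m n" and SUB: "S = U * (mat_adjoint B * B)"
    by blast
  define diag where "diag x M = four_block_mat (mat 1 1 (\<lambda>_. x)) (0\<^sub>m 1 n) (0\<^sub>m n 1) M"
    for x :: complex and M
  have diag_carrier: "diag x M \<in> carrier_mat ?m ?m" if "M \<in> carrier_mat n n" for x M
    using four_block_carrier_mat[of "mat 1 1 (\<lambda>_. x)" 1 1 M n n] that by (simp add: diag_def)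
  have diag_mult: "diag x M * diag y N = diag (x * y) (M * N)"
    if "M \<in> carrier_mat n n" "N \<in> carrier_mat n n" for x y M N
  proof -
    have "mat 1 1 (\<lambda>_. x) * mat 1 1 (\<lambda>_. y) = mat 1 1 (\<lambda>_. x * y)"
      by (rule eq_matI) (auto simp: scalar_prod_def)
    then show ?thesis
      unfolding diag_def using that
      by (subst mult_four_block_mat[of _ 1 1 _ n _ n _ _ 1 _ n])
         (auto intro!: cong_four_block_mat)
  qed
  have diag_adjoint: "mat_adjoint (diag x M) = diag (cnj x) (mat_adjoint M)"
    if "M \<in> carrier_mat n n" for x M
    unfolding diag_def using that
    by (subst mat_adjoint_four_block[of _ 1 1 _ n _ n])
       (auto intro!: cong_four_block_mat eq_matI simp: mat_adjoint_index)
  have T_diag: "T = diag e S"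
    using T T0 T0' by (intro eq_matI) (auto simp: diag_def S_def)
  \<comment> \<open>An eigenvalue 0 has \<open>sgn 0 = 0\<close>, which is not unimodular; any phase serves there.\<close>
  define z where "z = (if e = 0 then 1 else sgn e)"
  have z: "cnj z * z = 1" and z_norm: "z * of_real (cmod e) = e"
  proof -
    have "cmod z = 1" by (simp add: z_def norm_sgn)
    then show "cnj z * z = 1" by (simp add: mult.commute flip: complex_norm_square)
    show "z * of_real (cmod e) = e" by (simp add: z_def sgn_eq)
  qed
  define U' where "U' = diag z U"
  define B' where "B' = diag (of_real (sqrt (cmod e))) B"
  have U': "U' \<in> carrier_mat ?m ?m" and B': "B' \<in> carrier_mat ?m ?m"
    using U B by (auto simp: U'_def B'_def diag_carrier)
  have U'U': "mat_adjoint U' * U' = 1\<^sub>m ?m"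
  proof -
    have "mat_adjoint U' * U' = diag 1 (1\<^sub>m n)"
      using U UU z by (simp add: U'_def diag_adjoint diag_mult)
    also have "\<dots> = 1\<^sub>m ?m"
      by (auto simp: diag_def intro!: eq_matI)
    finally show ?thesis .
  qed
  have "U' * (mat_adjoint B' * B') = diag (z * of_real (cmod e)) (U * (mat_adjoint B * B))"
    using U B by (simp add: U'_def B'_def diag_adjoint diag_mult flip: of_real_mult)
  then have T_polar: "T = U' * (mat_adjoint B' * B')"
    using z_norm T_diag SUB by simp
  let ?U = "W * U' * mat_adjoint W" and ?B = "B' * mat_adjoint W"
  note assoc = assoc_mult_mat[of _ ?m ?m _ ?m _ ?m]
  have adjB': "mat_adjoint B' \<in> carrier_mat ?m ?m" and adjU': "mat_adjoint U' \<in> carrier_mat ?m ?m"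
    using U' B' by auto
  have cancel: "X * (mat_adjoint X * Y) = Y" "mat_adjoint X * (X * Y) = Y"
    if "X \<in> {W, U'}" "Y \<in> carrier_mat ?m ?m" for X Y
  proof -
    have X: "X \<in> carrier_mat ?m ?m" "mat_adjoint X \<in> carrier_mat ?m ?m"
      "mat_adjoint X * X = 1\<^sub>m ?m"
      using that W U' WW U'U' by auto
    have "X * mat_adjoint X = 1\<^sub>m ?m"
      by (rule mat_mult_left_right_inverse[OF X(2,1,3)])
    with X that show "X * (mat_adjoint X * Y) = Y" "mat_adjoint X * (X * Y) = Y"
      by (simp_all flip: assoc_mult_mat[of X ?m ?m "mat_adjoint X" ?m Y ?m]
          assoc_mult_mat[of "mat_adjoint X" ?m ?m X ?m Y ?m])
  qed
  have "mat_adjoint ?U * ?U = 1\<^sub>m ?m"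
    using W W' U' adjU' by (simp add: mat_adjoint_mult[of _ ?m ?m _ ?m] assoc cancel WW')
  moreover have "A = ?U * (mat_adjoint ?B * ?B)"
    using W W' U' B' adjB'
    by (simp add: AT T_polar mat_adjoint_mult[of _ ?m ?m _ ?m] assoc cancel)
  moreover have "?U \<in> carrier_mat ?m ?m" "?B \<in> carrier_mat ?m ?m"
    using W W' U' B' by auto
  ultimately show ?case by blast
qed

section \<open>Matrices with square blocks\<close>

lemma pair_index_less:
  fixes l c :: nat
  assumes "l < p" "c < n"
  shows "l * n + c < p * n"
proof -
  have "l * n + c < Suc l * n" using assms by simp
  also have "\<dots> \<le> p * n" using assms by (intro mult_le_mono1) simp
  finally show ?thesis .
qed

text \<open>
  Row and column indices of a matrix with blocks of size n are read as pairs of a block index (the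
  quotient by n) and an index inside the block (the remainder); sums over them become double sums.
\<close>

lemma sum_index_pairs:
  fixes f :: "nat \<Rightarrow> nat \<Rightarrow> 'a::comm_monoid_add"
  assumes "0 < n"
  shows "(\<Sum>x<p * n. f (x div n) (x mod n)) = (\<Sum>l<p. \<Sum>c<n. f l c)"
proof -
  have "(\<Sum>l<p. \<Sum>c<n. f l c) = (\<Sum>(l, c)\<in>{..<p} \<times> {..<n}. f l c)"
    by (rule sum.cartesian_product)
  also have "\<dots> = (\<Sum>x<p * n. f (x div n) (x mod n))"
  proof (rule sum.reindex_bij_witness[of _ "\<lambda>x. (x div n, x mod n)" "\<lambda>(l, c). l * n + c"])
    fix lc assume "lc \<in> {..<p} \<times> {..<n}"
    then show "(case lc of (l, c) \<Rightarrow> l * n + c) \<in> {..<p * n}"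
      by (auto intro: pair_index_less)
  qed (use assms in \<open>auto simp: less_mult_imp_div_less\<close>)
  finally show ?thesis by simp
qed

lemma div_mod_less_mult:
  fixes i :: nat
  assumes "i < p * n"
  shows "i div n < p" "i mod n < n" 
  using assms by (auto simp: less_mult_imp_div_less intro!: mod_less_divisor gr0I)

lemma diag_block_mat_index:
  assumes "set Ds \<subseteq> carrier_mat n n" "i < length Ds * n" "j < length Ds * n"
  shows "diag_block_mat Ds $$ (i, j)
    = (if i div n = j div n then Ds ! (i div n) $$ (i mod n, j mod n) else 0)"
  using assms
proof (induction Ds arbitrary: i j)
  case Nil
  then show ?case by simp
next
  case (Cons D Ds)
  then have n: "0 < n" by (auto intro!: gr0I)
  have D: "D \<in> carrier_mat n n" using Cons.prems by simp
  have "sum_list (map dim_row Ds) = length Ds * n" "sum_list (map dim_col Ds) = length Ds * n"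
    using Cons.prems(1) by (induction Ds) auto
  then have dims: "dim_row (diag_block_mat Ds) = length Ds * n"
    "dim_col (diag_block_mat Ds) = length Ds * n"
    by (simp_all add: dim_diag_block_mat)
  have IH: "diag_block_mat Ds $$ (i - n, j - n)
      = (if i div n = j div n then (D # Ds) ! (i div n) $$ (i mod n, j mod n) else 0)"
    if "\<not> i < n" "\<not> j < n"
  proof -
    have "i div n = Suc ((i - n) div n)" "j div n = Suc ((j - n) div n)"
      using that n by (simp_all add: le_div_geq)
    moreover have "i mod n = (i - n) mod n" "j mod n = (j - n) mod n"
      using that by (simp_all add: le_mod_geq)
    ultimately show ?thesis
      using Cons.IH[of "i - n" "j - n"] Cons.prems that by auto
  qed
  have "x div n = 0 \<longleftrightarrow> x < n" for x
    using n by (simp add: div_eq_0_iff)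
  then show ?case
    using Cons.prems D dims IH by (auto simp: Let_def)
qed

section \<open>Tensors given by their Fourier blocks\<close>

text \<open>
  The tensor whose block circulant matrix is block-diagonalised by the Fourier matrix into the
  blocks D 0, \<dots>, D (p - 1): its slices are the inverse Fourier transform of the sequence D, taken
  entry by entry.
\<close>

definition tensor_of_blocks :: "nat \<Rightarrow> nat \<Rightarrow> (nat \<Rightarrow> complex mat) \<Rightarrow> tensor3" where
  "tensor_of_blocks n p D
    = map (\<lambda>k. mat n n (\<lambda>(a, b). idft p (\<lambda>j. D j $$ (a, b)) (int k))) [0..<p]"

lemma tensor_of_blocks_carrier: "tensor_of_blocks n p D \<in> carrier_tensor n n p"
  by (auto simp: tensor_of_blocks_def carrier_tensor_def)

lemma tensor_of_blocks_index:
  "k < p \<Longrightarrow> a < n \<Longrightarrow> b < n \<Longrightarrow>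
    tensor_of_blocks n p D ! k $$ (a, b) = idft p (\<lambda>j. D j $$ (a, b)) (int k)"
  by (simp add: tensor_of_blocks_def)

lemma tensor_eqI:
  assumes "A \<in> carrier_tensor m n p" "B \<in> carrier_tensor m n p"
    and "\<And>k a b. k < p \<Longrightarrow> a < m \<Longrightarrow> b < n \<Longrightarrow> A ! k $$ (a, b) = B ! k $$ (a, b)"
  shows "A = B"
proof (rule nth_equalityI)
  show "length A = length B" using assms by (simp add: carrier_tensor_def)
  fix k assume "k < length A"
  then have "k < p" "A ! k \<in> carrier_mat m n" "B ! k \<in> carrier_mat m n"
    using assms(1,2) by (auto simp: carrier_tensor_def)
  then show "A ! k = B ! k"
    using assms(3) by (intro eq_matI) auto
qed

lemma int_cyclic_diff:
  assumes "r < p" "c < p"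
  shows "int ((p + r - c) mod p) = (int r - int c) mod int p"
proof -
  have "int (p + r - c) = int p + (int r - int c)" using assms by simp
  then show ?thesis by (simp add: zmod_int)
qed

lemma bcirc_tensor_of_blocks_index:
  assumes p: "0 < p" and i: "i < p * n" and j: "j < p * n"
  shows "bcirc (tensor_of_blocks n p D) $$ (i, j)
    = idft p (\<lambda>l. D l $$ (i mod n, j mod n)) (int (i div n) - int (j div n))"
proof -
  note d = carrier_tensor_dims[OF tensor_of_blocks_carrier[of n p D] p]
  show ?thesis
    using p i j div_mod_less_mult[OF i] div_mod_less_mult[OF j]
    by (simp add: bcirc_def d(1-3) tensor_of_blocks_index int_cyclic_diff idft_mod)
qed

lemma tprod_carrier:
  assumes "A \<in> carrier_tensor n n p" "B \<in> carrier_tensor n n p" "0 < p"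
  shows "A \<star> B \<in> carrier_tensor n n p"
proof -
  note dA = carrier_tensor_dims[OF assms(1,3)] and dB = carrier_tensor_dims[OF assms(2,3)]
  have "bcirc A * tunfold B \<in> carrier_mat (p * n) n"
    by (rule mult_carrier_mat[of _ _ "p * n"]) (simp_all add: bcirc_def tunfold_def dA dB)
  then show ?thesis
    unfolding tprod_def dA(1) using assms(3) by (rule tunfold_tfold)
qed

text \<open>
  The T-product is a cyclic convolution of slices with matrix multiplication as the product, so the
  convolution theorem, applied for each inner index c of the matrix products, makes it the blockwise
  product.
\<close>

lemma tprod_tensor_of_blocks:
  assumes n: "0 < n" and p: "0 < p"
    and D: "\<And>j. j < p \<Longrightarrow> D j \<in> carrier_mat n n" and E: "\<And>j. j < p \<Longrightarrow> E j \<in> carrier_mat n n"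
  shows "tensor_of_blocks n p D \<star> tensor_of_blocks n p E = tensor_of_blocks n p (\<lambda>j. D j * E j)"
    (is "?D \<star> ?E = _")
proof (rule tensor_eqI[OF tprod_carrier tensor_of_blocks_carrier])
  fix k a b assume k: "k < p" and a: "a < n" and b: "b < n"
  note dD = carrier_tensor_dims[OF tensor_of_blocks_carrier[of n p D] p]
    and dE = carrier_tensor_dims[OF tensor_of_blocks_carrier[of n p E] p]
  have ka: "k * n + a < p * n" using k a by (rule pair_index_less)
  have "(?D \<star> ?E) ! k $$ (a, b) = (bcirc ?D * tunfold ?E) $$ (k * n + a, b)"
    using k a b p by (simp add: tprod_def tfold_def dD(1-3) dE(1-3) bcirc_def tunfold_def)
  also have "\<dots> = (\<Sum>x<p * n. bcirc ?D $$ (k * n + a, x) * tunfold ?E $$ (x, b))"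
    using ka b
    by (simp add: scalar_prod_def lessThan_atLeast0 dD(1-3) dE(1-3) bcirc_def tunfold_def)
  also have "\<dots> = (\<Sum>x<p * n. idft p (\<lambda>j. D j $$ (a, x mod n)) (int k - int (x div n))
        * idft p (\<lambda>j. E j $$ (x mod n, b)) (int (x div n)))"
    using ka a b p div_mod_less_mult[of _ p n]
    by (intro sum.cong refl)
      (simp add: bcirc_tensor_of_blocks_index tunfold_def dE(1-3) tensor_of_blocks_index)
  also have "\<dots> = (\<Sum>c<n. \<Sum>l<p. idft p (\<lambda>j. D j $$ (a, c)) (int k - int l)
        * idft p (\<lambda>j. E j $$ (c, b)) (int l))"
    by (subst sum_index_pairs[OF n]) (rule sum.swap)
  also have "\<dots> = idft p (\<lambda>j. \<Sum>c<n. D j $$ (a, c) * E j $$ (c, b)) (int k)"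
    by (simp add: idft_convolution[OF p] idft_sum)
  also have "\<dots> = idft p (\<lambda>j. (D j * E j) $$ (a, b)) (int k)"
  proof (rule idft_cong)
    fix j assume "j < p"
    from D[OF this] E[OF this] show "(\<Sum>c<n. D j $$ (a, c) * E j $$ (c, b)) = (D j * E j) $$ (a, b)"
      using a b by (simp add: scalar_prod_def lessThan_atLeast0)
  qed
  finally show "(?D \<star> ?E) ! k $$ (a, b) = tensor_of_blocks n p (\<lambda>j. D j * E j) ! k $$ (a, b)"
    using k a b by (simp add: tensor_of_blocks_index)
qed (use p in \<open>simp_all add: tensor_of_blocks_carrier\<close>)

lemma tadjoint_index:
  assumes "A \<in> carrier_tensor m n p" "k < p" "a < n" "b < m"
  shows "tadjoint A ! k $$ (a, b) = cnj (A ! ((p - k) mod p) $$ (b, a))"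
proof -
  have "0 < p" using assms(2) by simp
  note d = carrier_tensor_dims[OF assms(1) this]
  have "A ! ((p - k) mod p) \<in> carrier_mat m n" using d(4) \<open>0 < p\<close> by simp
  then show ?thesis
    using assms d(1) by (simp add: tadjoint_nth mat_adjoint_index)
qed

lemma tadjoint_carrier:
  assumes "A \<in> carrier_tensor m n p"
  shows "tadjoint A \<in> carrier_tensor n m p"
  using assms by (cases A) (auto simp: carrier_tensor_def tadjoint_def)

text \<open>
  Conjugation of an inverse transform reverses its argument, and the reversal of the slices in the
  tensor adjoint undoes this.
\<close>

lemma tadjoint_tensor_of_blocks:
  assumes D: "\<And>j. j < p \<Longrightarrow> D j \<in> carrier_mat n n"
  shows "tadjoint (tensor_of_blocks n p D) = tensor_of_blocks n p (\<lambda>j. mat_adjoint (D j))"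
proof (rule tensor_eqI[OF tadjoint_carrier[OF tensor_of_blocks_carrier] tensor_of_blocks_carrier])
  fix k a b assume k: "k < p" and a: "a < n" and b: "b < n"
  then have p: "0 < p" by simp
  have "tadjoint (tensor_of_blocks n p D) ! k $$ (a, b)
      = cnj (idft p (\<lambda>j. D j $$ (b, a)) ((- int k) mod int p))"
    using k a b p int_cyclic_diff[of 0 p k]
    by (simp add: tadjoint_index[OF tensor_of_blocks_carrier] tensor_of_blocks_index)
  also have "\<dots> = idft p (\<lambda>j. cnj (D j $$ (b, a))) (int k)"
    using p by (simp add: idft_mod cnj_idft)
  also have "\<dots> = idft p (\<lambda>j. mat_adjoint (D j) $$ (a, b)) (int k)"
  proof (rule idft_cong)
    fix j assume "j < p"
    from D[OF this] show "cnj (D j $$ (b, a)) = mat_adjoint (D j) $$ (a, b)"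
      using a b by (simp add: mat_adjoint_index)
  qed
  finally show "tadjoint (tensor_of_blocks n p D) ! k $$ (a, b)
      = tensor_of_blocks n p (\<lambda>j. mat_adjoint (D j)) ! k $$ (a, b)"
    using k a b by (simp add: tensor_of_blocks_index)
qed

lemma tident_eq_tensor_of_blocks: "tident n p = tensor_of_blocks n p (\<lambda>_. 1\<^sub>m n)"
proof (rule tensor_eqI[OF _ tensor_of_blocks_carrier])
  show "tident n p \<in> carrier_tensor n n p"
    by (auto simp: tident_def carrier_tensor_def)
  fix k a b assume "k < p" "a < n" "b < n"
  then show "tident n p ! k $$ (a, b) = tensor_of_blocks n p (\<lambda>_. 1\<^sub>m n) ! k $$ (a, b)"
    by (simp add: tident_def tensor_of_blocks_index idft_const)
qed

lemma dft_mat_index: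
  assumes "j < p" "k < p"
  shows "dft_mat p $$ (j, k) = root_char p (- (int j * int k)) / of_real (sqrt (real p))"
proof -
  have "exp (- 2 * complex_of_real pi * \<i> / of_nat p) = root_char p (- 1)"
    by (simp add: root_char_def cis_conv_exp field_simps)
  then have "exp (- 2 * complex_of_real pi * \<i> / of_nat p) ^ (j * k) = root_char p (- (int j * int k))"
    using root_char_power[of p "-1" "j * k"] by simp
  then show ?thesis
    using assms by (simp add: dft_mat_def)
qed

text \<open>
  The Kronecker factors with the identity and the block-diagonal middle factor leave one term for
  each block l in every entry of the triple product. The two Fourier coefficients in this term combine
  to a character at the difference of the block indices, which is the inverse transform that
  defines the slices.
\<close>

lemma fourier_blocks_tensor_of_blocks:
  assumes n: "0 < n" and p: "0 < p" and D: "\<And>j. j < p \<Longrightarrow> D j \<in> carrier_mat n n"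
  shows "fourier_blocks n p (tensor_of_blocks n p D) (map D [0..<p])"
proof -
  let ?F = "dft_mat p \<otimes>\<^sub>K 1\<^sub>m n" and ?F' = "mat_adjoint (dft_mat p) \<otimes>\<^sub>K 1\<^sub>m n"
    and ?B = "diag_block_mat (map D [0..<p])"
  note d = carrier_tensor_dims[OF tensor_of_blocks_carrier[of n p D] p]
  have Ds: "set (map D [0..<p]) \<subseteq> carrier_mat n n" using D by auto
  have "map dim_row (map D [0..<p]) = map (\<lambda>_. n) [0..<p]"
       "map dim_col (map D [0..<p]) = map (\<lambda>_. n) [0..<p]"
    using carrier_matD[OF D] by simp_all
  then have "sum_list (map dim_row (map D [0..<p])) = p * n"
       "sum_list (map dim_col (map D [0..<p])) = p * n"
    by (simp_all only: sum_list_triv) simp_all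
  then have B: "?B \<in> carrier_mat (p * n) (p * n)"
    by (intro carrier_matI) (simp_all only: dim_diag_block_mat)
  have F: "?F \<in> carrier_mat (p * n) (p * n)" and F': "?F' \<in> carrier_mat (p * n) (p * n)"
    by (simp_all add: kron_def dft_mat_def)
  have B_index: "?B $$ (x, y)
      = (if x div n = y div n then D (x div n) $$ (x mod n, y mod n) else 0)"
    if "x < p * n" "y < p * n" for x y
    using that div_mod_less_mult[OF that(1)] by (simp add: diag_block_mat_index[OF Ds])
  have F_index: "?F $$ (x, y) = dft_mat p $$ (x div n, y div n) * (if x mod n = y mod n then 1 else 0)"
    if "x < p * n" "y < p * n" for x y
    using that div_mod_less_mult[OF that(1)] div_mod_less_mult[OF that(2)]
    by (simp add: kron_def dft_mat_def)
  have F'_index: "?F' $$ (x, y)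
      = cnj (dft_mat p $$ (y div n, x div n)) * (if x mod n = y mod n then 1 else 0)"
    if "x < p * n" "y < p * n" for x y
    using that div_mod_less_mult[OF that(1)] div_mod_less_mult[OF that(2)]
    by (simp add: kron_def dft_mat_def mat_adjoint_index)
  have BF_index: "(?B * ?F) $$ (x, j) = D (x div n) $$ (x mod n, j mod n) * dft_mat p $$ (x div n, j div n)"
    if x: "x < p * n" and j: "j < p * n" for x j
  proof -
    note xd = div_mod_less_mult[OF x] and jd = div_mod_less_mult[OF j]
    have "(?B * ?F) $$ (x, j) = (\<Sum>y<p * n. ?B $$ (x, y) * ?F $$ (y, j))"
      using B F x j by (simp add: scalar_prod_def lessThan_atLeast0)
    also have "\<dots> = (\<Sum>y<p * n. (if x div n = y div n then D (x div n) $$ (x mod n, y mod n) else 0)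
        * (dft_mat p $$ (y div n, j div n) * (if y mod n = j mod n then 1 else 0)))"
      using x j by (intro sum.cong) (simp_all only: B_index F_index lessThan_iff)
    also have "\<dots> = (\<Sum>l<p. \<Sum>c<n. (if x div n = l then D (x div n) $$ (x mod n, c) else 0)
        * (dft_mat p $$ (l, j div n) * (if c = j mod n then 1 else 0)))"
      by (rule sum_index_pairs[OF n])
    also have "\<dots> = (\<Sum>l<p. if l = x div n
        then D (x div n) $$ (x mod n, j mod n) * dft_mat p $$ (x div n, j div n) else 0)"
      using jd by (intro sum.cong) (auto simp: if_distrib[of "(*) _"] cong: if_cong)
    finally show ?thesis using xd by simp
  qed
  have "bcirc (tensor_of_blocks n p D) = ?F' * (?B * ?F)"
  proof (rule eq_matI)
    fix i j assume "i < dim_row (?F' * (?B * ?F))" "j < dim_col (?F' * (?B * ?F))"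
    then have i: "i < p * n" and j: "j < p * n" using F F' by auto
    note id = div_mod_less_mult[OF i] and jd = div_mod_less_mult[OF j]
    have twiddle: "cnj (dft_mat p $$ (l, i div n)) * dft_mat p $$ (l, j div n)
        = root_char p (int l * (int (i div n) - int (j div n))) / of_nat p" if l: "l < p" for l
    proof -
      have "cnj (dft_mat p $$ (l, i div n)) * dft_mat p $$ (l, j div n)
          = root_char p (int l * int (i div n)) * root_char p (- (int l * int (j div n)))
            / (of_real (sqrt (real p)) * of_real (sqrt (real p)))"
        using l id jd by (simp add: dft_mat_index cnj_root_char)
      also have "root_char p (int l * int (i div n)) * root_char p (- (int l * int (j div n)))
          = root_char p (int l * (int (i div n) - int (j div n)))"
        by (simp flip: root_char_add add: algebra_simps)
      also have "complex_of_real (sqrt (real p)) * of_real (sqrt (real p)) = of_nat p"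
        by (simp flip: of_real_mult)
      finally show ?thesis .
    qed
    have "(?F' * (?B * ?F)) $$ (i, j) = (\<Sum>x<p * n. ?F' $$ (i, x) * (?B * ?F) $$ (x, j))"
      using B F F' i j by (simp add: scalar_prod_def lessThan_atLeast0)
    also have "\<dots> = (\<Sum>x<p * n. (cnj (dft_mat p $$ (x div n, i div n)) * (if i mod n = x mod n then 1 else 0))
        * (D (x div n) $$ (x mod n, j mod n) * dft_mat p $$ (x div n, j div n)))"
      using i j by (intro sum.cong) (simp_all only: F'_index BF_index lessThan_iff)
    also have "\<dots> = (\<Sum>l<p. \<Sum>c<n. (cnj (dft_mat p $$ (l, i div n)) * (if i mod n = c then 1 else 0))
        * (D l $$ (c, j mod n) * dft_mat p $$ (l, j div n)))"
      by (rule sum_index_pairs[OF n])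
    also have "\<dots> = (\<Sum>l<p. (cnj (dft_mat p $$ (l, i div n)) * dft_mat p $$ (l, j div n))
        * D l $$ (i mod n, j mod n))"
      using id by (intro sum.cong) (auto simp: if_distrib[of "(*) _"] if_distrib[of "\<lambda>x. x * _"] mult_ac cong: if_cong)
    also have "\<dots> = idft p (\<lambda>l. D l $$ (i mod n, j mod n)) (int (i div n) - int (j div n))"
      by (simp add: twiddle idft_def sum_divide_distrib)
    finally show "bcirc (tensor_of_blocks n p D) $$ (i, j) = (?F' * (?B * ?F)) $$ (i, j)"
      using bcirc_tensor_of_blocks_index[OF p i j] by simp
  qed (use F F' in \<open>auto simp: bcirc_def d(1-3)\<close>)
  also have "\<dots> = ?F' * ?B * ?F"
    by (rule assoc_mult_mat[symmetric, OF F' B F])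
  finally show ?thesis
    using Ds by (simp add: fourier_blocks_def)
qed

text \<open>
  The blocks are the discrete Fourier transform of the slices. Conjugate transposition of a block
  conjugates the characters and replaces each slice by the one with the opposite index modulo p,
  because the tensor is Hermitian; reversing the summation index restores the original sum.
\<close>

lemma hermitian_tensor_blocks:
  assumes A: "A \<in> carrier_tensor n n p" and H: "hermitian_tensor A"
  obtains D where "\<And>j. D j \<in> carrier_mat n n" "\<And>j. hermitian_mat (D j)"
    "A = tensor_of_blocks n p D"
proof
  define D where
    "D j = mat n n (\<lambda>(a, b). \<Sum>k<p. root_char p (- (int j * int k)) * A ! k $$ (a, b))" for j
  show D: "D j \<in> carrier_mat n n" for j by (simp add: D_def)
  show "A = tensor_of_blocks n p D"
  proof (rule tensor_eqI[OF A tensor_of_blocks_carrier])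
    fix k a b assume "k < p" "a < n" "b < n"
    then show "A ! k $$ (a, b) = tensor_of_blocks n p D ! k $$ (a, b)"
      by (simp add: tensor_of_blocks_index D_def idft_inversion)
  qed
  show "hermitian_mat (D j)" for j
    unfolding hermitian_mat_def
  proof (rule eq_matI)
    fix a b assume "a < dim_row (D j)" "b < dim_col (D j)"
    then have ab: "a < n" "b < n" by (simp_all add: D_def)
    have sym: "cnj (A ! k $$ (b, a)) = A ! ((p - k) mod p) $$ (a, b)" if "k < p" for k
      using tadjoint_index[OF A that ab(2,1)] H by (simp add: hermitian_tensor_def)
    have "mat_adjoint (D j) $$ (a, b) = (\<Sum>k<p. cnj (root_char p (- (int j * int k)) * A ! k $$ (b, a)))"
      using ab by (simp add: mat_adjoint_index D_def)
    also have "\<dots> = (\<Sum>k<p. root_char p (- (int j * int ((p - k) mod p))) * A ! ((p - k) mod p) $$ (a, b))"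
    proof (intro sum.cong refl)
      fix k assume "k \<in> {..<p}"
      then have k: "k < p" by simp
      have "root_char p (- (int j * int ((p - k) mod p))) = root_char p (int j * int k)"
        using k int_cyclic_diff[of 0 p k] root_char_mod[of p "- int j" "- int k"] by simp
      then show "cnj (root_char p (- (int j * int k)) * A ! k $$ (b, a))
          = root_char p (- (int j * int ((p - k) mod p))) * A ! ((p - k) mod p) $$ (a, b)"
        using k by (simp add: cnj_root_char sym)
    qed
    also have "\<dots> = (\<Sum>k<p. root_char p (- (int j * int k)) * A ! k $$ (a, b))"
      by (rule sum.reindex_bij_witness[of _ "\<lambda>k. (p - k) mod p" "\<lambda>k. (p - k) mod p"])
         (auto simp: mod_if)
    finally show "mat_adjoint (D j) $$ (a, b) = D j $$ (a, b)"
      using ab by (simp add: D_def)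
  qed (simp_all add: D_def)
qed

section \<open>Polar decomposition of Hermitian tensors\<close>

theorem theorem9:
  fixes n p :: nat and A :: tensor3
  assumes "0 < n" and "0 < p"
    and "A \<in> carrier_tensor n n p"
    and "hermitian_tensor A"
  shows "\<exists>U P. unitary_tensor n p U \<and> (T_pos_def n p P \<or> T_pos_semidef n p P) \<and> A = U \<star> P"
proof -
  obtain D where D: "\<And>j. D j \<in> carrier_mat n n" "\<And>j. hermitian_mat (D j)"
    and A: "A = tensor_of_blocks n p D"
    using hermitian_tensor_blocks[OF assms(3,4)] by metis
  have "\<forall>j. \<exists>U B. U \<in> carrier_mat n n \<and> B \<in> carrier_mat n n \<and>
      mat_adjoint U * U = 1\<^sub>m n \<and> D j = U * (mat_adjoint B * B)"
    using hermitian_polar_decomposition[OF D] by blast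
  then obtain U B where U: "\<And>j. U j \<in> carrier_mat n n" and B: "\<And>j. B j \<in> carrier_mat n n"
    and UU: "\<And>j. mat_adjoint (U j) * U j = 1\<^sub>m n"
    and DUB: "\<And>j. D j = U j * (mat_adjoint (B j) * B j)"
    by metis
  have UU': "U j * mat_adjoint (U j) = 1\<^sub>m n" for j
    by (rule mat_mult_left_right_inverse[OF _ U UU]) (simp add: U)
  let ?P = "\<lambda>j. mat_adjoint (B j) * B j"
  have P: "pos_semidef_mat n (?P j)" for j by (rule pos_semidef_gram[OF B])
  then have Pc: "?P j \<in> carrier_mat n n" and Ph: "mat_adjoint (?P j) = ?P j" for j
    by (simp_all add: pos_semidef_mat_def hermitian_mat_def)
  have "unitary_tensor n p (tensor_of_blocks n p U)"
    using U assms(1,2)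
    by (simp add: unitary_tensor_def tensor_of_blocks_carrier tadjoint_tensor_of_blocks
        tprod_tensor_of_blocks tident_eq_tensor_of_blocks UU UU')
  moreover have "T_pos_semidef n p (tensor_of_blocks n p ?P)"
    unfolding T_pos_semidef_def hermitian_tensor_def
  proof (intro conjI exI)
    show "tadjoint (tensor_of_blocks n p ?P) = tensor_of_blocks n p ?P"
      using Pc by (simp add: tadjoint_tensor_of_blocks Ph)
    show "fourier_blocks n p (tensor_of_blocks n p ?P) (map ?P [0..<p])"
      using Pc assms(1,2) by (intro fourier_blocks_tensor_of_blocks)
    show "\<forall>M \<in> set (map ?P [0..<p]). pos_semidef_mat n M" using P by auto
  qed (rule tensor_of_blocks_carrier)
  moreover have "A = tensor_of_blocks n p U \<star> tensor_of_blocks n p ?P"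
    using U Pc assms(1,2) by (simp add: A tprod_tensor_of_blocks flip: DUB)
  ultimately show ?thesis by blast
qed

end
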